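(* Let $n\ge 1$ be an integer, let $\omega\in\mathbb{R}$ and $\phi_1,\dots,\phi_n\in\mathbb{R}$, and let $$f^{+}(t)=e^{-t}\prod_{i=1}^{n}\cos^2\left(\frac{\omega t-\phi_i}{2}\right),\qquad t\ge 0,$$ be the associated exponential cosine-square function. Then for all $t\ge 0$, $$f^{+}(t)=c^{(n)} e^{-t}+e^{-t}\sum_{k=1}^{n}a^{(n)}_k\cos(k\omega t)+e^{-t}\sum_{k=1}^{n}b^{(n)}_k\sin(k\omega t),$$ where the real coefficients $a^{(n)}_k,b^{(n)}_k$ ($1\le k\le n$) and $c^{(n)}$ are determined recursively as follows. For $n=1$: $$a^{(1)}_1=\tfrac12\cos\phi_1,\quad b^{(1)}_1=\tfrac12\sin\phi_1,\quad c^{(1)}=\tfrac12.$$ For $n=2$: $$a^{(2)}_1=\tfrac14(\cos\phi_1+\cos\phi_2),\quad b^{(2)}_1=\tfrac14(\sin\phi_1+\sin\phi_2),$$ $$a^{(2)}_2=\tfrac18\cos(\phi_1+\phi_2),\quad b^{(2)}_2=\tfrac18\sin(\phi_1+\phi_2),\quad c^{(2)}=\tfrac14+\tfrac18\cos(\phi_1-\phi_2).$$ For $n>2$ and $1<k<n-1$: $$a^{(n)}_k=\tfrac12a^{(n-1)}_k+\tfrac12\,\frac{a^{(n-1)}_{k-1}+a^{(n-1)}_{k+1}}{2}\cos\phi_n+\tfrac12\,\frac{b^{(n-1)}_{k+1}-b^{(n-1)}_{k-1}}{2}\sin\phi_n,$$ $$b^{(n)}_k=\tfrac12b^{(n-1)}_k+\tfrac12\,\frac{b^{(n-1)}_{k-1}+b^{(n-1)}_{k+1}}{2}\cos\phi_n+\tfrac12\,\frac{a^{(n-1)}_{k-1}-a^{(n-1)}_{k+1}}{2}\sin\phi_n.$$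 For $n>2$: $$c^{(n)}=\tfrac12c^{(n-1)}+\tfrac14a^{(n-1)}_1\cos\phi_n+\tfrac14b^{(n-1)}_1\sin\phi_n,$$ $$a^{(n)}_1=\tfrac12a^{(n-1)}_1+\tfrac14a^{(n-1)}_2\cos\phi_n+\tfrac14b^{(n-1)}_2\sin\phi_n+\tfrac12c^{(n-1)}\cos\phi_n,$$ $$b^{(n)}_1=\tfrac12b^{(n-1)}_1+\tfrac14b^{(n-1)}_2\cos\phi_n-\tfrac14a^{(n-1)}_2\sin\phi_n+\tfrac12c^{(n-1)}\sin\phi_n,$$ $$a^{(n)}_{n-1}=\tfrac14a^{(n-1)}_{n-2}\cos\phi_n-\tfrac14b^{(n-1)}_{n-2}\sin\phi_n+\tfrac12a^{(n-1)}_{n-1},$$ $$b^{(n)}_{n-1}=\tfrac14b^{(n-1)}_{n-2}\cos\phi_n+\tfrac14a^{(n-1)}_{n-2}\sin\phi_n+\tfrac12b^{(n-1)}_{n-1},$$ $$a^{(n)}_n=\tfrac14a^{(n-1)}_{n-1}\cos\phi_n-\tfrac14b^{(n-1)}_{n-1}\sin\phi_n,$$ $$b^{(n)}_n=\tfrac14b^{(n-1)}_{n-1}\cos\phi_n+\tfrac14a^{(n-1)}_{n-1}\sin\phi_n.$$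
   Context: The coefficients with superscript $(m)$, $1\le m\le n$, depend only on $\phi_1,\dots,\phi_m$: the coefficients with superscript $(1)$ and $(2)$ are given explicitly, and for $m>2$ those with superscript $(m)$ are computed from those with superscript $(m-1)$ and the parameter $\phi_m$. *)

theory Defs
  imports Complex_Main
begin

definition exp_cos_sq :: "nat \<Rightarrow> real \<Rightarrow> (nat \<Rightarrow> real) \<Rightarrow> real \<Rightarrow> real" where
  "exp_cos_sq n \<omega> \<phi> t = exp (- t) * (\<Prod>i=1..n. (cos ((\<omega> * t - \<phi> i) / 2))\<^sup>2)"

(* The superscript (n) is the argument n and the subscript is the argument k.  For n > 2 the
   ranges k = 1, 1 < k < n - 1, k = n - 1 and k = n are disjoint and cover 1 <= k <= n.
   Outside 1 <= k <= n, and for n = 0, the values are set to 0; the other equations never use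
   them. *)
function coeff_a :: "(nat \<Rightarrow> real) \<Rightarrow> nat \<Rightarrow> nat \<Rightarrow> real"
  and coeff_b :: "(nat \<Rightarrow> real) \<Rightarrow> nat \<Rightarrow> nat \<Rightarrow> real"
  and coeff_c :: "(nat \<Rightarrow> real) \<Rightarrow> nat \<Rightarrow> real"
where
  "coeff_a \<phi> n k =
    (if n = 1 \<and> k = 1 then 1/2 * cos (\<phi> 1)
     else if n = 2 \<and> k = 1 then 1/4 * (cos (\<phi> 1) + cos (\<phi> 2))
     else if n = 2 \<and> k = 2 then 1/8 * cos (\<phi> 1 + \<phi> 2)
     else if n > 2 \<and> 1 < k \<and> k < n - 1 then
         1/2 * coeff_a \<phi> (n-1) k
       + 1/2 * ((coeff_a \<phi> (n-1) (k-1) + coeff_a \<phi> (n-1) (k+1)) / 2) * cos (\<phi> n)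
       + 1/2 * ((coeff_b \<phi> (n-1) (k+1) - coeff_b \<phi> (n-1) (k-1)) / 2) * sin (\<phi> n)
     else if n > 2 \<and> k = 1 then
         1/2 * coeff_a \<phi> (n-1) 1 + 1/4 * coeff_a \<phi> (n-1) 2 * cos (\<phi> n)
       + 1/4 * coeff_b \<phi> (n-1) 2 * sin (\<phi> n) + 1/2 * coeff_c \<phi> (n-1) * cos (\<phi> n)
     else if n > 2 \<and> k = n - 1 then
         1/4 * coeff_a \<phi> (n-1) (n-2) * cos (\<phi> n) - 1/4 * coeff_b \<phi> (n-1) (n-2) * sin (\<phi> n)
       + 1/2 * coeff_a \<phi> (n-1) (n-1)
     else if n > 2 \<and> k = n then
         1/4 * coeff_a \<phi> (n-1) (n-1) * cos (\<phi> n) - 1/4 * coeff_b \<phi> (n-1) (n-1) * sin (\<phi> n)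
     else 0)"
| "coeff_b \<phi> n k =
    (if n = 1 \<and> k = 1 then 1/2 * sin (\<phi> 1)
     else if n = 2 \<and> k = 1 then 1/4 * (sin (\<phi> 1) + sin (\<phi> 2))
     else if n = 2 \<and> k = 2 then 1/8 * sin (\<phi> 1 + \<phi> 2)
     else if n > 2 \<and> 1 < k \<and> k < n - 1 then
         1/2 * coeff_b \<phi> (n-1) k
       + 1/2 * ((coeff_b \<phi> (n-1) (k-1) + coeff_b \<phi> (n-1) (k+1)) / 2) * cos (\<phi> n)
       + 1/2 * ((coeff_a \<phi> (n-1) (k-1) - coeff_a \<phi> (n-1) (k+1)) / 2) * sin (\<phi> n)
     else if n > 2 \<and> k = 1 then
         1/2 * coeff_b \<phi> (n-1) 1 + 1/4 * coeff_b \<phi> (n-1) 2 * cos (\<phi> n)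
       - 1/4 * coeff_a \<phi> (n-1) 2 * sin (\<phi> n) + 1/2 * coeff_c \<phi> (n-1) * sin (\<phi> n)
     else if n > 2 \<and> k = n - 1 then
         1/4 * coeff_b \<phi> (n-1) (n-2) * cos (\<phi> n) + 1/4 * coeff_a \<phi> (n-1) (n-2) * sin (\<phi> n)
       + 1/2 * coeff_b \<phi> (n-1) (n-1)
     else if n > 2 \<and> k = n then
         1/4 * coeff_b \<phi> (n-1) (n-1) * cos (\<phi> n) + 1/4 * coeff_a \<phi> (n-1) (n-1) * sin (\<phi> n)
     else 0)"
| "coeff_c \<phi> n =
    (if n = 1 then 1/2
     else if n = 2 then 1/4 + 1/8 * cos (\<phi> 1 - \<phi> 2)
     else if n > 2 then
         1/2 * coeff_c \<phi> (n-1) + 1/4 * coeff_a \<phi> (n-1) 1 * cos (\<phi> n)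
       + 1/4 * coeff_b \<phi> (n-1) 1 * sin (\<phi> n)
     else 0)"
  by pat_completeness auto
termination
  by (relation "measure (\<lambda>x. case x of Inl (\<phi>, n, k) \<Rightarrow> n | Inr (Inl (\<phi>, n, k)) \<Rightarrow> n
        | Inr (Inr (\<phi>, n)) \<Rightarrow> n)") auto

(* The unguarded equations would make the simplifier loop. *)
declare coeff_a.simps [simp del] coeff_b.simps [simp del] coeff_c.simps [simp del]

end

(* Multiplying by cos^2((x - p)/2) = 1/2 + cos(x - p)/2 halves a trigonometric polynomial and sends
   a quarter of each harmonic k, with its phase shifted by p, to the harmonics k + 1 and k - 1.
   With the coefficients extended by zero outside 1..n, all cases of the recursion, including
   the explicit values for n = 2, are the coefficients of this one operation, so the expansion
   follows by induction from n = 1. *)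
theory Submission
  imports Defs
begin

lemma cos_half_squared: "(cos (x / 2))\<^sup>2 = 1 / 2 + 1 / 2 * cos (x :: real)"
  using cos_double_cos [of "x / 2"] by (simp add: field_simps)

lemma coeff_ab_eq_0:
  assumes "k = 0 \<or> n < k"
  shows "coeff_a \<phi> n k = 0" and "coeff_b \<phi> n k = 0"
proof -
  show "coeff_a \<phi> n k = 0"
    using assms by (subst coeff_a.simps) auto
  show "coeff_b \<phi> n k = 0"
    using assms by (subst coeff_b.simps) auto
qed

lemma coeff_c_1: "coeff_c \<phi> (Suc 0) = 1 / 2"
  and coeff_a_1: "coeff_a \<phi> (Suc 0) (Suc 0) = 1 / 2 * cos (\<phi> 1)"
  and coeff_b_1: "coeff_b \<phi> (Suc 0) (Suc 0) = 1 / 2 * sin (\<phi> 1)"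
  by (simp_all add: coeff_c.simps [of _ "Suc 0"] coeff_a.simps [of _ "Suc 0"]
      coeff_b.simps [of _ "Suc 0"])

text \<open>For \<open>m = 1\<close> this recovers the explicit value at \<open>n = 2\<close>: the
  addition formula splits \<open>cos (\<phi> 1 - \<phi> 2)\<close> into the two products on the
  right.\<close>

lemma coeff_c_Suc:
  assumes "m \<ge> 1"
  shows "coeff_c \<phi> (Suc m) = 1/2 * coeff_c \<phi> m + 1/4 * coeff_a \<phi> m 1 * cos (\<phi> (Suc m))
    + 1/4 * coeff_b \<phi> m 1 * sin (\<phi> (Suc m))"
proof (cases "m = 1")
  case True
  then show ?thesis
    by (simp add: coeff_c.simps [of _ "Suc (Suc 0)"] coeff_c_1 coeff_a_1 coeff_b_1
        cos_diff numeral_2_eq_2 algebra_simps)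
next
  case False
  then show ?thesis
    using assms by (simp add: coeff_c.simps [of _ "Suc m"])
qed

text \<open>One formula for all \<open>k \<ge> 1\<close>, so that the induction needs no case split
  on \<open>k\<close>. The constant term is stored in \<open>coeff_c\<close>, while
  \<open>coeff_a \<phi> m 0\<close> is 0; hence the extra summand at \<open>k = 1\<close>. Its
  weight is 1/2 rather than 1/4 because a constant times \<open>cos (x - p)\<close> yields a single
  harmonic instead of two.\<close>

lemma coeff_a_Suc:
  assumes "m \<ge> 1" and "k \<ge> 1"
  shows "coeff_a \<phi> (Suc m) k = 1/2 * coeff_a \<phi> m k
    + 1/4 * (coeff_a \<phi> m (k-1) + coeff_a \<phi> m (Suc k)) * cos (\<phi> (Suc m))
    + 1/4 * (coeff_b \<phi> m (Suc k) - coeff_b \<phi> m (k-1)) * sin (\<phi> (Suc m))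
    + (if k = 1 then 1/2 * coeff_c \<phi> m * cos (\<phi> (Suc m)) else 0)"
proof (cases "m = 1")
  case True
  consider "k = 1" | "k = 2" | "k > 2"
    using assms by linarith
  then show ?thesis
    using True
    by cases (auto simp: coeff_a.simps [of _ "Suc (Suc 0)"] coeff_a_1 coeff_b_1 coeff_c_1
        coeff_ab_eq_0 cos_add numeral_2_eq_2 algebra_simps)
next
  case False
  with assms have m: "m \<ge> 2" by simp
  \<comment> \<open>With \<open>n = Suc m\<close>, the first four cases are the ranges of the
    definition. For \<open>k \<ge> m\<close> the terms with index above \<open>m\<close> vanish,
    which gives the shorter boundary formulas.\<close>
  consider "k = 1" | "1 < k" "k < m" | "k = m" | "k = Suc m" | "k > Suc m"
    using assms by linarith
  then show ?thesis
    using m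
    by cases (auto simp: coeff_a.simps [of _ "Suc m"] coeff_ab_eq_0
        numeral_2_eq_2 field_simps)
qed

lemma coeff_b_Suc:
  assumes "m \<ge> 1" and "k \<ge> 1"
  shows "coeff_b \<phi> (Suc m) k = 1/2 * coeff_b \<phi> m k
    + 1/4 * (coeff_b \<phi> m (k-1) + coeff_b \<phi> m (Suc k)) * cos (\<phi> (Suc m))
    + 1/4 * (coeff_a \<phi> m (k-1) - coeff_a \<phi> m (Suc k)) * sin (\<phi> (Suc m))
    + (if k = 1 then 1/2 * coeff_c \<phi> m * sin (\<phi> (Suc m)) else 0)"
proof (cases "m = 1")
  case True
  consider "k = 1" | "k = 2" | "k > 2"
    using assms by linarith
  then show ?thesis
    using True
    by cases (auto simp: coeff_b.simps [of _ "Suc (Suc 0)"] coeff_a_1 coeff_b_1 coeff_c_1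
        coeff_ab_eq_0 sin_add numeral_2_eq_2 algebra_simps)
next
  case False
  with assms have m: "m \<ge> 2" by simp
  consider "k = 1" | "1 < k" "k < m" | "k = m" | "k = Suc m" | "k > Suc m"
    using assms by linarith
  then show ?thesis
    using m
    by cases (auto simp: coeff_b.simps [of _ "Suc m"] coeff_ab_eq_0
        numeral_2_eq_2 field_simps)
qed

text \<open>Product-to-sum: the coefficient vector \<open>(a, b)\<close> is rotated by
  \<open>p\<close> in the raised harmonic and by \<open>- p\<close> in the lowered one.\<close>

lemma harmonic_mult_cos:
  fixes a b x y p :: real
  shows "(a * cos y + b * sin y) * cos (x - p) =
    1/2 * ((a * cos p - b * sin p) * cos (y + x) + (a * sin p + b * cos p) * sin (y + x))
    + 1/2 * ((a * cos p + b * sin p) * cos (y - x) + (b * cos p - a * sin p) * sin (y - x))"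
  by (simp add: cos_add sin_add cos_diff sin_diff algebra_simps)

lemma prod_cos_squared_expansion:
  assumes "n \<ge> 1"
  shows "(\<Prod>i=1..n. (cos ((x - \<phi> i) / 2))\<^sup>2) =
    coeff_c \<phi> n + (\<Sum>k=1..n. coeff_a \<phi> n k * cos (real k * x) + coeff_b \<phi> n k * sin (real k * x))"
  using assms
proof (induction n rule: nat_induct_at_least)
  case base
  show ?case
    by (simp add: cos_half_squared cos_diff coeff_a_1 coeff_b_1 coeff_c_1 algebra_simps)
next
  case (Suc m)
  define p where "p = \<phi> (Suc m)"
  define c where "c = coeff_c \<phi> m"
  define a where "a = coeff_a \<phi> m"
  define b where "b = coeff_b \<phi> m"
  \<comment> \<open>\<open>U k\<close> and \<open>D k\<close> are twice the parts of
    \<open>T k * cos (x - p)\<close> that move up to harmonic \<open>k + 1\<close> and down to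
    harmonic \<open>k - 1\<close>.\<close>
  define T where "T k = a k * cos (real k * x) + b k * sin (real k * x)" for k
  define U where "U k = (a k * cos p - b k * sin p) * cos (real (Suc k) * x)
    + (a k * sin p + b k * cos p) * sin (real (Suc k) * x)" for k
  define D where "D k = (a k * cos p + b k * sin p) * cos (real (k - 1) * x)
    + (b k * cos p - a k * sin p) * sin (real (k - 1) * x)" for k
  have zero: "a k = 0" "b k = 0" if "k = 0 \<or> m < k" for k
    using that by (simp_all add: a_def b_def coeff_ab_eq_0)
  have T_mult: "T k * cos (x - p) = 1/2 * U k + 1/2 * D k" if "k \<ge> 1" for k
  proof -
    have "real (Suc k) * x = real k * x + x" "real (k - 1) * x = real k * x - x"
      using that by (simp_all add: of_nat_diff distrib_right left_diff_distrib)
    then show ?thesis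
      unfolding T_def U_def D_def
      using harmonic_mult_cos [of "a k" "real k * x" "b k" x p] by (simp only:)
  qed
  \<comment> \<open>Indexing by the target harmonic costs nothing here, since
    \<open>U 0 = 0\<close>.\<close>
  have sum_U: "(\<Sum>k=1..Suc m. U (k - 1)) = (\<Sum>k=1..m. U k)"
  proof -
    have "(\<Sum>k=1..Suc m. U (k - 1)) = (\<Sum>k=0..m. U k)"
      using sum.shift_bounds_cl_Suc_ivl [of "\<lambda>k. U (k - 1)" 0 m] by simp
    then show ?thesis
      by (simp add: sum.atLeast_Suc_atMost U_def zero)
  qed
  \<comment> \<open>\<open>D 1\<close> lands on harmonic 0, outside the range of target harmonics,
    and must be added separately; \<open>D k\<close> vanishes for \<open>k > m\<close>.\<close>
  have sum_D: "D 1 + (\<Sum>k=1..Suc m. D (Suc k)) = (\<Sum>k=1..m. D k)"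
  proof -
    have "(\<Sum>k=1..Suc m. D (Suc k)) = (\<Sum>k=2..Suc (Suc m). D k)"
      using sum.shift_bounds_cl_Suc_ivl [of D 1 "Suc m"] by (simp add: numeral_2_eq_2)
    then have "D 1 + (\<Sum>k=1..Suc m. D (Suc k)) = (\<Sum>k=1..Suc (Suc m). D k)"
      by (simp add: sum.atLeast_Suc_atMost [of "Suc 0"] numeral_2_eq_2 del: sum.cl_ivl_Suc)
    then show ?thesis
      by (simp add: D_def zero)
  qed
  have coeffs: "coeff_a \<phi> (Suc m) k * cos (real k * x) + coeff_b \<phi> (Suc m) k * sin (real k * x) =
      1/2 * T k + 1/4 * U (k - 1) + 1/4 * D (Suc k)
      + (if k = 1 then 1/2 * c * cos (x - p) else 0)" if "k \<ge> 1" for k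
    using that Suc.hyps
    by (simp add: coeff_a_Suc coeff_b_Suc T_def U_def D_def a_def b_def c_def p_def
        cos_diff algebra_simps add_divide_distrib diff_divide_distrib)
  have "(\<Sum>k=1..Suc m. coeff_a \<phi> (Suc m) k * cos (real k * x)
        + coeff_b \<phi> (Suc m) k * sin (real k * x)) =
      (\<Sum>k=1..Suc m. 1/2 * T k + 1/4 * U (k - 1) + 1/4 * D (Suc k)
        + (if k = 1 then 1/2 * c * cos (x - p) else 0))"
    by (rule sum.cong [OF refl], rule coeffs) simp
  also have "\<dots> = 1/2 * (\<Sum>k=1..Suc m. T k) + 1/4 * (\<Sum>k=1..Suc m. U (k - 1))
      + 1/4 * (\<Sum>k=1..Suc m. D (Suc k)) + 1/2 * c * cos (x - p)"
    by (simp only: sum.distrib sum_distrib_left sum.delta finite_atLeastAtMost) simp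
  also have "(\<Sum>k=1..Suc m. T k) = (\<Sum>k=1..m. T k)"
    by (simp add: T_def zero)
  \<comment> \<open>The missing \<open>1/4 * D 1\<close> is what \<open>coeff_c_Suc\<close> adds to
    \<open>1/2 * c\<close>, so the constant term completes the sum of the
    \<open>D k\<close>.\<close>
  finally have new: "coeff_c \<phi> (Suc m) + (\<Sum>k=1..Suc m. coeff_a \<phi> (Suc m) k * cos (real k * x)
        + coeff_b \<phi> (Suc m) k * sin (real k * x)) =
      1/2 * c + 1/2 * c * cos (x - p) + 1/2 * (\<Sum>k=1..m. T k)
      + 1/4 * (\<Sum>k=1..m. U k) + 1/4 * (\<Sum>k=1..m. D k)"
    using Suc.hyps sum_U sum_D
    by (simp add: coeff_c_Suc D_def a_def b_def c_def p_def algebra_simps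
        del: sum.cl_ivl_Suc)
  have "(\<Sum>k=1..m. T k) * cos (x - p) = (\<Sum>k=1..m. 1/2 * U k + 1/2 * D k)"
    unfolding sum_distrib_right by (rule sum.cong [OF refl], rule T_mult) simp
  also have "\<dots> = 1/2 * (\<Sum>k=1..m. U k) + 1/2 * (\<Sum>k=1..m. D k)"
    by (simp only: sum.distrib sum_distrib_left)
  finally have prod: "(\<Sum>k=1..m. T k) * cos (x - p) =
      1/2 * (\<Sum>k=1..m. U k) + 1/2 * (\<Sum>k=1..m. D k)" .
  \<comment> \<open>Multiplying the expansion for \<open>m\<close> by the new factor gives the same
    expression as \<open>new\<close>, once \<open>prod\<close> rewrites the last product.\<close>
  have "(\<Prod>i=1..Suc m. (cos ((x - \<phi> i) / 2))\<^sup>2) =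
      (c + (\<Sum>k=1..m. T k)) * (1/2 + 1/2 * cos (x - p))"
    using Suc.IH by (simp add: cos_half_squared p_def c_def T_def a_def b_def)
  also have "\<dots> = 1/2 * c + 1/2 * c * cos (x - p) + 1/2 * (\<Sum>k=1..m. T k)
      + 1/2 * ((\<Sum>k=1..m. T k) * cos (x - p))"
    by (simp add: algebra_simps)
  finally show ?case
    unfolding new prod by simp
qed

theorem theorem1:
  fixes n :: nat and \<omega> :: real and \<phi> :: "nat \<Rightarrow> real"
  assumes "n \<ge> 1"
  shows "\<forall>t\<ge>0. exp_cos_sq n \<omega> \<phi> t =
    coeff_c \<phi> n * exp (- t)
    + exp (- t) * (\<Sum>k=1..n. coeff_a \<phi> n k * cos (real k * \<omega> * t))
    + exp (- t) * (\<Sum>k=1..n. coeff_b \<phi> n k * sin (real k * \<omega> * t))"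
  unfolding exp_cos_sq_def prod_cos_squared_expansion [OF assms]
  by (simp add: sum.distrib algebra_simps)

end
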